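(* Let $\alpha\in[0,1]$ and let $n\ge 1$ be an integer. Suppose the dataset is divided into mutually exclusive training and test sets $\Omega_T$ and $\Omega_t$ by random permutation, where the training set accounts for a fraction $\alpha$ of the samples and the test set for $1-\alpha$, and suppose each sample is an $n\times n$ patch of pixels. Then for an arbitrary test sample $S$, the probability that $S$ shares information with the training dataset is $$p_I(S)=1-(1-\alpha)^{4n^2-1},$$ and the expected information benefit of $S$ from the training dataset is $$E[I(S)]=(n^2-1)\,\alpha\,H(S),$$ where $H(S)$ is the entropy of $S$.
   Context: Samples are indexed by integer grid positions: $S(x,y)$ denotes the sample ($n\times n$ pixel patch) at position $(x,y)$ of the image. $\Omega$ is the set of all samples, partitioned into the training set $\Omega_T$ and the test set $\Omega_t$. Random sampling model: $P\{S'\in\Omega_T\}=\alpha$ and $P\{S'\in\Omega_t\}=1-\alpha$ for each sample $S'$, and the memberships of different samples are independent. Boundary effects of the image are ignored: $S$ is treated as having all of its neighbouring samples present. Sharing information: a test sample $S=S(x,y)$ shares information with the training dataset if and only if at least one of the other samples in the square of size $2n$ centered at $S(x,y)$ belongs to $\Omega_T$. By the paper's convention this square contains $4n^2$ samples counting $S$ itself, hence $4n^2-1$ samples other than $S$. The quantity $p_I(S)$ is the probability of this event for the test sample $S$. Information share ratio: for samples $S=S(x,y)$ and $S'=S(x',y')$, with mutual information $I(S,S')$, $$\gamma(S,S')=\frac{I(S,S')}{H(S)}.$$ Each pixel is assumed to contain the same amount of information, and the ratio is then represented by $$\gamma(S,S')=\frac{i_x i_y}{n^2},\qquad i_x=(n-|x-x'|)_+,\quad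 i_y=(n-|y-y'|)_+,$$ where $(t)_+=t$ if $t>0$ and $(t)_+=0$ otherwise. Expected information benefit: for a test sample $S$, $E[I(S)]$ is the sum over all samples $S'\neq S$ of the expected contribution of $S'$, where the contribution of $S'$ is $\gamma(S,S')H(S)$ if $S'\in\Omega_T$ and $0$ otherwise. *)

theory Defs
  imports "HOL-Probability.Probability"
begin

type_synonym pos = "int \<times> int"

section \<open>Samples and their information content\<close>

text \<open>
  An image is a random field \<open>pix\<close> of pixel values on an information space with measure
  \<open>N\<close>. A sample is identified with its position \<open>S = (x, y)\<close>; its content is the block of
  pixels \<open>(x + i, y + j)\<close> with \<open>0 \<le> i, j < n\<close>, regarded as one random variable that is indexed
  by the offset \<open>(i, j)\<close> (and is \<open>undefined\<close> at all other offsets).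
\<close>

definition patch_offsets :: "nat \<Rightarrow> pos set" where
  "patch_offsets n = {0..<int n} \<times> {0..<int n}"

definition patch :: "nat \<Rightarrow> (pos \<Rightarrow> 'w \<Rightarrow> 'v) \<Rightarrow> pos \<Rightarrow> 'w \<Rightarrow> (pos \<Rightarrow> 'v)" where
  "patch n pix S = (\<lambda>w. \<lambda>d\<in>patch_offsets n. pix (fst S + fst d, snd S + snd d) w)"

definition sample_entropy ::
  "'w measure \<Rightarrow> real \<Rightarrow> nat \<Rightarrow> (pos \<Rightarrow> 'w \<Rightarrow> 'v) \<Rightarrow> pos \<Rightarrow> real" where
  "sample_entropy N b n pix S =
     prob_space.entropy N b (count_space (patch n pix S ` space N)) (patch n pix S)"

definition sample_mutual_information ::
  "'w measure \<Rightarrow> real \<Rightarrow> nat \<Rightarrow> (pos \<Rightarrow> 'w \<Rightarrow> 'v) \<Rightarrow> pos \<Rightarrow> pos \<Rightarrow> real" where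
  "sample_mutual_information N b n pix S S' =
     prob_space.mutual_information N b
       (count_space (patch n pix S ` space N)) (count_space (patch n pix S' ` space N))
       (patch n pix S) (patch n pix S')"

definition info_share_ratio ::
  "'w measure \<Rightarrow> real \<Rightarrow> nat \<Rightarrow> (pos \<Rightarrow> 'w \<Rightarrow> 'v) \<Rightarrow> pos \<Rightarrow> pos \<Rightarrow> real" where
  "info_share_ratio N b n pix S S' =
     sample_mutual_information N b n pix S S' / sample_entropy N b n pix S"

definition overlap_length :: "nat \<Rightarrow> int \<Rightarrow> int \<Rightarrow> int" where
  "overlap_length n u v = max 0 (int n - \<bar>u - v\<bar>)"

section \<open>Random division into training and test samples\<close>

locale random_division = prob_space M
  for M :: "'a measure" +
  fixes \<Omega> :: "pos set" and train test :: "'a \<Rightarrow> pos set" and \<alpha> :: real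
  assumes covers: "w \<in> space M \<Longrightarrow> train w \<union> test w = \<Omega>"
    and mutually_exclusive: "w \<in> space M \<Longrightarrow> train w \<inter> test w = {}"
    and prob_train: "S \<in> \<Omega> \<Longrightarrow> prob {w \<in> space M. S \<in> train w} = \<alpha>"
    and prob_test: "S \<in> \<Omega> \<Longrightarrow> prob {w \<in> space M. S \<in> test w} = 1 - \<alpha>"
    and indep_membership: "indep_events (\<lambda>S. {w \<in> space M. S \<in> train w}) \<Omega>"

text \<open>
  The square of size \<open>2 n\<close> centered at a sample is half-open, so that it contains exactly
  \<open>4 n\<^sup>2\<close> integer positions, the centre included.
\<close>

definition square :: "nat \<Rightarrow> pos \<Rightarrow> pos set" where
  "square n S = {fst S - int n..<fst S + int n} \<times> {snd S - int n..<snd S + int n}"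

definition shares_information :: "nat \<Rightarrow> pos set \<Rightarrow> pos \<Rightarrow> bool" where
  "shares_information n T S \<longleftrightarrow> (\<exists>S'\<in>square n S - {S}. S' \<in> T)"

text \<open>
  The next two quantities take the law \<open>P\<close> of the random division as a parameter: it can be
  the original measure or that measure conditioned on \<open>S\<close> being a test sample.
\<close>

definition share_prob :: "'a measure \<Rightarrow> ('a \<Rightarrow> pos set) \<Rightarrow> nat \<Rightarrow> pos \<Rightarrow> real" where
  "share_prob P train n S = measure P {w \<in> space P. shares_information n (train w) S}"

definition expected_benefit ::
  "'a measure \<Rightarrow> pos set \<Rightarrow> ('a \<Rightarrow> pos set) \<Rightarrow>
   'w measure \<Rightarrow> real \<Rightarrow> nat \<Rightarrow> (pos \<Rightarrow> 'w \<Rightarrow> 'v) \<Rightarrow> pos \<Rightarrow> real" where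
  "expected_benefit P \<Omega> train N b n pix S =
     (\<Sum>S'\<in>\<Omega> - {S}. \<integral>w. (if S' \<in> train w
        then info_share_ratio N b n pix S S' * sample_entropy N b n pix S else 0) \<partial>P)"

end

theory Submission
  imports Defs
begin

text \<open>
  Independence carries over from membership in the training set to membership in the test set. So
  the other positions of the square are all test samples with probability
  \<open>(1 - \<alpha>) ^ (4 * n\<^sup>2 - 1)\<close>, also conditionally on \<open>S\<close> being a test sample. The benefit is, by
  linearity, \<open>\<alpha>\<close> times the sum of the overlap areas divided by \<open>n\<^sup>2\<close>. The overlap area is a product
  of two triangular functions of total mass \<open>n\<^sup>2\<close>, so the sum of the ratios is \<open>n\<^sup>2\<close>, from which
  the ratio \<open>1\<close> of \<open>S\<close> with itself is removed.
\<close>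

text \<open>Independence of a family that mixes events with complements. The excluded events are
  added one at a time: excluding \<open>A k\<close> subtracts the part inside \<open>A k\<close>,
  which replaces a product by itself times \<open>1 - prob (A k)\<close>. The set \<open>J\<close>
  stays arbitrary, since the induction hypothesis is used at \<open>J\<close> and at
  \<open>insert k J\<close>.\<close>

lemma (in prob_space) prob_Int_diff_Union_indep_events:
  assumes indep: "indep_events A I"
    and "finite K" "finite J" "J \<subseteq> I" "K \<subseteq> I" "J \<inter> K = {}"
  shows "prob ((space M \<inter> (\<Inter>j\<in>J. A j)) - (\<Union>k\<in>K. A k)) =
    (\<Prod>j\<in>J. prob (A j)) * (\<Prod>k\<in>K. 1 - prob (A k))"
  using assms(2-)
proof (induction K arbitrary: J rule: finite_induct)
  case empty
  show ?case
  \<comment> \<open>\<open>indep_events\<close> gives a product only for nonempty index sets. For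
    \<open>J = {}\<close> the intersection is \<open>UNIV\<close>, which \<open>space M\<close> cuts
    down to an event of probability 1.\<close>
  proof (cases "J = {}")
    case True
    then show ?thesis by (simp add: prob_space)
  next
    case False
    have "A j \<subseteq> space M" if "j \<in> J" for j
      using indep that empty.prems by (auto simp: indep_events_def dest!: sets.sets_into_space)
    then have "space M \<inter> (\<Inter>j\<in>J. A j) = (\<Inter>j\<in>J. A j)"
      using False by auto
    then show ?thesis
      using indep False empty.prems by (simp add: indep_events_def)
  qed
next
  case (insert k K)
  have ev: "A i \<in> events" if "i \<in> I" for i
    using indep that by (auto simp: indep_events_def)
  let ?B = "(space M \<inter> (\<Inter>j\<in>J. A j)) - (\<Union>k\<in>K. A k)"
  let ?C = "(space M \<inter> (\<Inter>j\<in>insert k J. A j)) - (\<Union>k\<in>K. A k)"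
  have fin: "space M \<inter> (\<Inter>j\<in>F. A j) \<in> events" if "finite F" "F \<subseteq> I" for F
  proof (cases "F = {}")
    case False
    then show ?thesis using that ev by (intro sets.Int sets.top sets.finite_INT) auto
  qed simp
  have U: "(\<Union>k\<in>K. A k) \<in> events"
    using insert.hyps insert.prems ev by (intro sets.finite_UN) auto
  have "prob (?B - ?C) = prob ?B - prob ?C"
    using insert.prems fin[of J] fin[of "insert k J"] U by (intro finite_measure_Diff sets.Diff) auto
  moreover have "?B - ?C = (space M \<inter> (\<Inter>j\<in>J. A j)) - (\<Union>k\<in>insert k K. A k)"
    by auto
  moreover have "prob ?B = (\<Prod>j\<in>J. prob (A j)) * (\<Prod>k\<in>K. 1 - prob (A k))"
    using insert.prems by (intro insert.IH) auto
  \<comment> \<open>The index sets remain disjoint because \<open>k\<close> is not in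
    \<open>K\<close>.\<close>
  moreover have "prob ?C = (\<Prod>j\<in>insert k J. prob (A j)) * (\<Prod>k\<in>K. 1 - prob (A k))"
    using insert.prems insert.hyps by (intro insert.IH) auto
  moreover have "k \<notin> J" using insert.prems by auto
  ultimately show ?case
    using insert.prems(1) insert.hyps by (simp add: algebra_simps)
qed

lemma card_square: "card (square n S) = 4 * n\<^sup>2"
  by (simp add: square_def card_cartesian_product power2_eq_square nat_mult_distrib)

text \<open>From \<open>n\<close> to \<open>Suc n\<close> each of the \<open>2 * n\<close> old terms
  grows by 1, and the new endpoints \<open>- int (Suc n)\<close> and \<open>int n\<close> contribute
  0 and 1. The total gain \<open>2 * n + 1\<close> is the difference of consecutive squares.\<close>

lemma sum_triangle: "(\<Sum>k\<in>{- int n..<int n}. int n - \<bar>k\<bar>) = (int n)\<^sup>2"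
proof (induction n)
  case (Suc n)
  have "{- int (Suc n)..<int (Suc n)} =
      insert (- int (Suc n)) (insert (int n) {- int n..<int n})"
    by auto
  moreover have "(\<Sum>k\<in>{- int n..<int n}. int (Suc n) - \<bar>k\<bar>) =
      (\<Sum>k\<in>{- int n..<int n}. (int n - \<bar>k\<bar>) + 1)"
    by (intro sum.cong) auto
  ultimately show ?case
    using Suc by (simp add: sum.distrib power2_eq_square) (simp add: algebra_simps)
qed simp

lemma sum_overlap_length: "(\<Sum>v\<in>{u - int n..<u + int n}. overlap_length n u v) = (int n)\<^sup>2"
proof -
  have "(\<Sum>v\<in>{u - int n..<u + int n}. overlap_length n u v) =
      (\<Sum>k\<in>{- int n..<int n}. int n - \<bar>k\<bar>)"
    \<comment> \<open>On this interval the distance of \<open>v\<close> from \<open>u\<close> is at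
      most \<open>n\<close>, so the truncation at 0 changes nothing.\<close>
    by (rule sum.reindex_bij_witness[of _ "\<lambda>k. u + k" "\<lambda>v. v - u"])
      (auto simp: overlap_length_def)
  then show ?thesis by (simp add: sum_triangle)
qed

lemma overlap_length_self: "overlap_length n u u = int n"
  by (simp add: overlap_length_def)

lemma sum_overlap_area:
  assumes "finite \<Omega>" and "square n S \<subseteq> \<Omega>"
  shows "(\<Sum>S'\<in>\<Omega>. overlap_length n (fst S) (fst S') * overlap_length n (snd S) (snd S')) =
    (int n)\<^sup>2 * (int n)\<^sup>2"
proof -
  have "(\<Sum>S'\<in>\<Omega>. overlap_length n (fst S) (fst S') * overlap_length n (snd S) (snd S')) =
      (\<Sum>S'\<in>square n S. overlap_length n (fst S) (fst S') * overlap_length n (snd S) (snd S'))"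
    \<comment> \<open>Outside the square some coordinate is at distance at least \<open>n\<close>,
      so one overlap factor vanishes. This includes the edges missing from the half-open
      square.\<close>
    using assms by (intro sum.mono_neutral_right) (auto simp: square_def overlap_length_def)
  also have "\<dots> = (\<Sum>u\<in>{fst S - int n..<fst S + int n}. overlap_length n (fst S) u) *
      (\<Sum>v\<in>{snd S - int n..<snd S + int n}. overlap_length n (snd S) v)"
    by (simp add: square_def sum_product sum.cartesian_product case_prod_beta)
  finally show ?thesis by (simp add: sum_overlap_length)
qed

text \<open>By linearity, \<open>P\<close> enters only through the probabilities that single
  positions are training samples. Hence one lemma serves both the original law and the conditioned
  one.\<close>

lemma expected_benefit_eq:
  fixes N :: "'w measure" and pix :: "pos \<Rightarrow> 'w \<Rightarrow> 'v"
  assumes n: "n \<ge> 1" and "finite \<Omega>" and S: "S \<in> \<Omega>" and "square n S \<subseteq> \<Omega>"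
    and ratio: "\<And>S'. S' \<in> \<Omega> \<Longrightarrow> info_share_ratio N b n pix S S' =
        real_of_int (overlap_length n (fst S) (fst S') * overlap_length n (snd S) (snd S')) /
        (real n)\<^sup>2"
    and prob: "\<And>S'. S' \<in> \<Omega> - {S} \<Longrightarrow> measure P {w \<in> space P. S' \<in> train w} = \<alpha>"
  shows "expected_benefit P \<Omega> train N b n pix S =
    ((real n)\<^sup>2 - 1) * \<alpha> * sample_entropy N b n pix S"
proof -
  let ?o = "\<lambda>S'. overlap_length n (fst S) (fst S') * overlap_length n (snd S) (snd S')"
  let ?H = "sample_entropy N b n pix S"
  have "(\<integral>w. (if S' \<in> train w then info_share_ratio N b n pix S S' * ?H else 0) \<partial>P) =
      real_of_int (?o S') * (\<alpha> * ?H / (real n)\<^sup>2)"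
    if "S' \<in> \<Omega> - {S}" for S'
  proof -
    let ?c = "info_share_ratio N b n pix S S' * ?H"
    have "(\<integral>w. (if S' \<in> train w then ?c else 0) \<partial>P) =
        (\<integral>w. indicator {w \<in> space P. S' \<in> train w} w * ?c \<partial>P)"
      by (intro Bochner_Integration.integral_cong) (auto simp: indicator_def)
    also have "\<dots> = \<alpha> * ?c"
      using prob[OF that] by (simp add: Int_def conj_commute)
    finally show ?thesis
      using ratio that by simp
  qed
  then have "expected_benefit P \<Omega> train N b n pix S =
      real_of_int (\<Sum>S'\<in>\<Omega> - {S}. ?o S') * (\<alpha> * ?H / (real n)\<^sup>2)"
    unfolding expected_benefit_def of_int_sum sum_distrib_right by (intro sum.cong refl)
  \<comment> \<open>The omitted term is the overlap of \<open>S\<close> with itself, of area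
    \<open>n\<^sup>2\<close>.\<close>
  also have "(\<Sum>S'\<in>\<Omega> - {S}. ?o S') = (int n)\<^sup>2 * ((int n)\<^sup>2 - 1)"
    using assms
    by (simp add: sum_diff1 sum_overlap_area overlap_length_self right_diff_distrib)
      (simp add: power2_eq_square)
  finally show ?thesis
    using n by simp
qed

context random_division
begin

lemma train_event: "S \<in> \<Omega> \<Longrightarrow> {w \<in> space M. S \<in> train w} \<in> events"
  using indep_membership by (auto simp: indep_events_def)

lemma test_event_eq:
  "S \<in> \<Omega> \<Longrightarrow> {w \<in> space M. S \<in> test w} = space M - {w \<in> space M. S \<in> train w}"
  using covers mutually_exclusive by blast

text \<open>Conditioning on \<open>S\<close> being a test sample yields a probability measure only
  if this event is not null; this is where \<alpha> < 1 enters.\<close>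

lemma test_event_nonnull:
  assumes "S \<in> \<Omega>" "\<alpha> < 1"
  shows "emeasure M {w \<in> space M. S \<in> test w} \<noteq> 0"
  using prob_test[OF assms(1)] assms(2) by (auto simp: measure_def)

lemma prob_no_train:
  assumes "finite K" "K \<subseteq> \<Omega>"
  shows "prob {w \<in> space M. \<forall>S'\<in>K. S' \<notin> train w} = (1 - \<alpha>) ^ card K"
proof -
  \<comment> \<open>Every position of \<open>K\<close> is excluded and none is required, so the
    mixed product rule applies with \<open>J = {}\<close>.\<close>
  have "{w \<in> space M. \<forall>S'\<in>K. S' \<notin> train w} =
      (space M \<inter> (\<Inter>j\<in>{}. {w \<in> space M. j \<in> train w})) - (\<Union>k\<in>K. {w \<in> space M. k \<in> train w})"
    by auto
  also have "prob \<dots> = (\<Prod>k\<in>K. 1 - prob {w \<in> space M. k \<in> train w})"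
    using prob_Int_diff_Union_indep_events[OF indep_membership, of K "{}"] assms by simp
  also have "\<dots> = (\<Prod>k\<in>K. 1 - \<alpha>)"
    using assms prob_train by (intro prod.cong) auto
  finally show ?thesis by simp
qed

lemma prob_test_train:
  assumes "S \<in> \<Omega>" "S' \<in> \<Omega>" "S \<noteq> S'"
  shows "prob ({w \<in> space M. S \<in> test w} \<inter> {w \<in> space M. S' \<in> train w}) = (1 - \<alpha>) * \<alpha>"
proof -
  have "{w \<in> space M. S \<in> test w} \<inter> {w \<in> space M. S' \<in> train w} =
      (space M \<inter> (\<Inter>j\<in>{S'}. {w \<in> space M. j \<in> train w})) -
        (\<Union>k\<in>{S}. {w \<in> space M. k \<in> train w})"
    using assms by (auto simp: test_event_eq)
  then show ?thesis
    using prob_Int_diff_Union_indep_events[OF indep_membership, of "{S}" "{S'}"] assms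
    by (simp add: prob_train)
qed

text \<open>The complement is a union of training events over the square, which is finite as a
  subset of \<Omega>.\<close>

lemma no_sharing_event:
  assumes "finite \<Omega>" "square n S \<subseteq> \<Omega>"
  shows "{w \<in> space M. \<not> shares_information n (train w) S} \<in> events"
proof -
  have "{w \<in> space M. \<not> shares_information n (train w) S} =
      space M - (\<Union>S'\<in>square n S - {S}. {w \<in> space M. S' \<in> train w})"
    by (auto simp: shares_information_def)
  moreover have "(\<Union>S'\<in>square n S - {S}. {w \<in> space M. S' \<in> train w}) \<in> events"
    using assms train_event by (intro sets.finite_UN) (auto intro: finite_subset)
  ultimately show ?thesis by auto
qed

lemma sharing_event_eq:
  "{w \<in> space M. shares_information n (train w) S} =
    space M - {w \<in> space M. \<not> shares_information n (train w) S}"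
  by auto

lemma share_prob_eq:
  assumes n: "n \<ge> 1" and \<Omega>: "finite \<Omega>" "square n S \<subseteq> \<Omega>"
  shows "share_prob M train n S = 1 - (1 - \<alpha>) ^ (4 * n\<^sup>2 - 1)"
proof -
  \<comment> \<open>Since the centre lies in its square, removing it lowers the cardinality by
    exactly 1.\<close>
  have "S \<in> square n S" using n by (cases S) (auto simp: square_def)
  then have "card (square n S - {S}) = 4 * n\<^sup>2 - 1"
    by (simp add: card_square)
  moreover have "prob {w \<in> space M. \<not> shares_information n (train w) S} =
      (1 - \<alpha>) ^ card (square n S - {S})"
    using prob_no_train[of "square n S - {S}"] \<Omega>
    by (auto simp: shares_information_def intro: finite_subset)
  ultimately show ?thesis
    using prob_compl[OF no_sharing_event[OF \<Omega>]] unfolding share_prob_def sharing_event_eq by simp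
qed

text \<open>If \<open>S\<close> is a test sample and nothing is shared, then the whole square,
  centre included, avoids the training set. This has probability
  \<open>(1 - \<alpha>) ^ (4 * n\<^sup>2)\<close>, and dividing by the probability
  \<open>1 - \<alpha>\<close> of the condition cancels one factor.\<close>

lemma share_prob_test_eq:
  assumes n: "n \<ge> 1" and \<Omega>: "finite \<Omega>" "square n S \<subseteq> \<Omega>" and "S \<in> \<Omega>" and "\<alpha> < 1"
  shows "share_prob (uniform_measure M {w \<in> space M. S \<in> test w}) train n S =
    1 - (1 - \<alpha>) ^ (4 * n\<^sup>2 - 1)"
proof -
  let ?T = "{w \<in> space M. S \<in> test w}" and ?E = "{w \<in> space M. \<not> shares_information n (train w) S}"
  have pos: "prob ?T = 1 - \<alpha>" using prob_test \<open>S \<in> \<Omega>\<close> by simp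
  interpret P: prob_space "uniform_measure M ?T"
    using test_event_nonnull assms by (intro prob_space_uniform_measure) auto
  have "S \<in> square n S" using n by (cases S) (auto simp: square_def)
  then have "?T \<inter> ?E = {w \<in> space M. \<forall>S'\<in>square n S. S' \<notin> train w}"
    using \<open>S \<in> \<Omega>\<close> by (auto simp: test_event_eq shares_information_def)
  then have "prob (?T \<inter> ?E) = (1 - \<alpha>) ^ (4 * n\<^sup>2)"
    using prob_no_train[of "square n S"] \<Omega> by (simp add: finite_subset card_square)
  also have "\<dots> = (1 - \<alpha>) * (1 - \<alpha>) ^ (4 * n\<^sup>2 - 1)"
    using n by (intro power_minus_mult[symmetric, THEN trans]) (auto simp: mult.commute)
  finally have "measure (uniform_measure M ?T) ?E = (1 - \<alpha>) ^ (4 * n\<^sup>2 - 1)"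
    using pos \<open>\<alpha> < 1\<close> \<Omega> \<open>S \<in> \<Omega>\<close> by (simp add: test_event_nonnull no_sharing_event)
  moreover have "?E \<in> P.events" using no_sharing_event[OF \<Omega>] by simp
  ultimately show ?thesis
    using P.prob_compl[of ?E] unfolding share_prob_def by (simp add: sharing_event_eq)
qed

lemma prob_train_given_test:
  assumes "S \<in> \<Omega>" "S' \<in> \<Omega>" "S \<noteq> S'" "\<alpha> < 1"
  shows "measure (uniform_measure M {w \<in> space M. S \<in> test w}) {w \<in> space M. S' \<in> train w} = \<alpha>"
  using assms
  by (simp add: test_event_nonnull train_event prob_test_train prob_test)

end

theorem mainTheorem1:
  fixes M :: "'a measure" and N :: "'w measure" and b \<alpha> :: real and n :: nat
    and \<Omega> :: "pos set" and train test :: "'a \<Rightarrow> pos set"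
    and pix :: "pos \<Rightarrow> 'w \<Rightarrow> 'v" and S :: pos
  assumes alpha: "0 \<le> \<alpha>" "\<alpha> \<le> 1"
    and n: "n \<ge> 1"
    and division: "random_division M \<Omega> train test \<alpha>"
    and finite: "finite \<Omega>"
    and sample: "S \<in> \<Omega>"
    and neighbours: "square n S \<subseteq> \<Omega>"
    and info: "information_space N b"
    and pixels: "\<And>S' d. S' \<in> \<Omega> \<Longrightarrow> d \<in> patch_offsets n \<Longrightarrow>
      simple_function N (pix (fst S' + fst d, snd S' + snd d))"
    and ratio: "\<And>x y x' y'. (x, y) \<in> \<Omega> \<Longrightarrow> (x', y') \<in> \<Omega> \<Longrightarrow>
      info_share_ratio N b n pix (x, y) (x', y') =
        real_of_int (overlap_length n x x' * overlap_length n y y') / (real n)\<^sup>2"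
  shows "share_prob M train n S = 1 - (1 - \<alpha>) ^ (4 * n\<^sup>2 - 1) \<and>
    expected_benefit M \<Omega> train N b n pix S =
      ((real n)\<^sup>2 - 1) * \<alpha> * sample_entropy N b n pix S \<and>
    (\<alpha> < 1 \<longrightarrow>
      (let P = uniform_measure M {w \<in> space M. S \<in> test w} in
        share_prob P train n S = 1 - (1 - \<alpha>) ^ (4 * n\<^sup>2 - 1) \<and>
        expected_benefit P \<Omega> train N b n pix S =
          ((real n)\<^sup>2 - 1) * \<alpha> * sample_entropy N b n pix S))"
proof -
  interpret random_division M \<Omega> train test \<alpha> by (rule division)
  have r: "info_share_ratio N b n pix S S' =
      real_of_int (overlap_length n (fst S) (fst S') * overlap_length n (snd S) (snd S')) / (real n)\<^sup>2"
    if "S' \<in> \<Omega>" for S'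
    using ratio[of "fst S" "snd S" "fst S'" "snd S'"] that sample by simp
  have "expected_benefit M \<Omega> train N b n pix S =
      ((real n)\<^sup>2 - 1) * \<alpha> * sample_entropy N b n pix S"
    using prob_train by (intro expected_benefit_eq n finite sample neighbours r) auto
  \<comment> \<open>By independence, conditioning on the status of \<open>S\<close> leaves the
    training probability of every other position at \<alpha>.\<close>
  moreover have "expected_benefit (uniform_measure M {w \<in> space M. S \<in> test w}) \<Omega> train N b n pix S =
      ((real n)\<^sup>2 - 1) * \<alpha> * sample_entropy N b n pix S" if "\<alpha> < 1"
    using prob_train_given_test[OF sample _ _ that]
    by (intro expected_benefit_eq n finite sample neighbours r) auto
  ultimately show ?thesis
    using share_prob_eq[OF n finite neighbours] share_prob_test_eq[OF n finite neighbours sample]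
    by (simp add: Let_def)
qed

end
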